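(* Let $D_1\subset\mathbb{C}^{n_1}$ and $D_2\subset\mathbb{C}^{n_2}$ be Kobayashi hyperbolic domains (i.e. $k_{D_1}$ and $k_{D_2}$ are distances), each admitting a non-constant bounded holomorphic function (for example, bounded domains). Then $D_1\times D_2$ is not Gromov $k$-hyperbolic.
   Context: Let $\mathbb{D}$ be the open unit disc in $\mathbb{C}$. For a domain $D\subset\mathbb{C}^n$, the Lempert function is $l_D(z,w)=\inf\{\tanh^{-1}|\alpha| : \exists\,\varphi:\mathbb{D}\to D \text{ holomorphic with } \varphi(0)=z,\ \varphi(\alpha)=w\}$, and the Kobayashi (pseudo)distance $k_D$ is the largest pseudodistance on $D$ not exceeding $l_D$. For a metric space $(X,d)$ and $x,y,z\in X$, the Gromov product is $(x,y)_z=d(x,z)+d(z,y)-d(x,y)$. Put $S_d(p,q,x,w)=\min\{(p,x)_w,(x,q)_w\}-(p,q)_w$. The space $(X,d)$ is Gromov hyperbolic if $\sup_{p,q,x,w\in X}S_d(p,q,x,w)<\infty$. A domain $D$ is Gromov $k$-hyperbolic if $(D,k_D)$ is Gromov hyperbolic. *)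

theory Defs
  imports "HOL-Complex_Analysis.Complex_Analysis"
begin

definition domain_Cn :: "(complex ^ 'n) set \<Rightarrow> bool" where
  "domain_Cn D \<longleftrightarrow> open D \<and> connected D \<and> D \<noteq> {}"

text \<open>Holomorphy in several variables: at every point the real Frechet derivative exists
  and is complex linear.\<close>

definition holomorphic_fun :: "(complex ^ 'n) set \<Rightarrow> (complex ^ 'n \<Rightarrow> complex) \<Rightarrow> bool" where
  "holomorphic_fun D f \<longleftrightarrow>
     (\<forall>z\<in>D. \<exists>f'. (f has_derivative f') (at z) \<and> (\<forall>c v. f' (c *s v) = c * f' v))"

definition analytic_disc :: "(complex ^ 'n) set \<Rightarrow> (complex \<Rightarrow> complex ^ 'n) \<Rightarrow> bool" where
  "analytic_disc D \<phi> \<longleftrightarrow>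
     (\<forall>i. (\<lambda>\<zeta>. \<phi> \<zeta> $ i) holomorphic_on ball 0 1) \<and> \<phi> ` ball 0 1 \<subseteq> D"

text \<open>The values are extended reals so that the infimum over an empty set of discs
  would be infinity.\<close>

definition lempert :: "(complex ^ 'n) set \<Rightarrow> complex ^ 'n \<Rightarrow> complex ^ 'n \<Rightarrow> ereal" where
  "lempert D z w =
     Inf {ereal (artanh (cmod \<alpha>)) | \<alpha>. \<alpha> \<in> ball 0 1 \<and>
            (\<exists>\<phi>. analytic_disc D \<phi> \<and> \<phi> 0 = z \<and> \<phi> \<alpha> = w)}"

definition pseudodistance_on :: "'a set \<Rightarrow> ('a \<Rightarrow> 'a \<Rightarrow> real) \<Rightarrow> bool" where
  "pseudodistance_on X d \<longleftrightarrow>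
     (\<forall>x\<in>X. d x x = 0) \<and>
     (\<forall>x\<in>X. \<forall>y\<in>X. 0 \<le> d x y \<and> d x y = d y x) \<and>
     (\<forall>x\<in>X. \<forall>y\<in>X. \<forall>z\<in>X. d x z \<le> d x y + d y z)"

text \<open>The largest pseudodistance below the Lempert function is the pointwise supremum of all
  of them; on a domain it is finite, since any two points are joined by a finite chain of discs.
  The value 0 outside \<open>D\<close> is a convention needed only because \<^locale>\<open>Metric_space\<close> requires
  symmetry and nonnegativity on the whole type.\<close>

definition kobayashi :: "(complex ^ 'n) set \<Rightarrow> complex ^ 'n \<Rightarrow> complex ^ 'n \<Rightarrow> real" where
  "kobayashi D z w =
     (if z \<in> D \<and> w \<in> D
      then Sup {d z w | d. pseudodistance_on D d \<and>
                  (\<forall>x\<in>D. \<forall>y\<in>D. ereal (d x y) \<le> lempert D x y)}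
      else 0)"

definition kobayashi_hyperbolic :: "(complex ^ 'n) set \<Rightarrow> bool" where
  "kobayashi_hyperbolic D \<longleftrightarrow> Metric_space D (kobayashi D)"

text \<open>The Gromov product is taken without the customary factor 1/2.\<close>

definition gromov_product :: "('a \<Rightarrow> 'a \<Rightarrow> real) \<Rightarrow> 'a \<Rightarrow> 'a \<Rightarrow> 'a \<Rightarrow> real" where
  "gromov_product d x y z = d x z + d z y - d x y"

definition gromov_S :: "('a \<Rightarrow> 'a \<Rightarrow> real) \<Rightarrow> 'a \<Rightarrow> 'a \<Rightarrow> 'a \<Rightarrow> 'a \<Rightarrow> real" where
  "gromov_S d p q x w =
     min (gromov_product d p x w) (gromov_product d x q w) - gromov_product d p q w"

definition gromov_hyperbolic :: "'a set \<Rightarrow> ('a \<Rightarrow> 'a \<Rightarrow> real) \<Rightarrow> bool" where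
  "gromov_hyperbolic X d \<longleftrightarrow>
     bdd_above {gromov_S d p q x w | p q x w. p \<in> X \<and> q \<in> X \<and> x \<in> X \<and> w \<in> X}"

definition gromov_k_hyperbolic :: "(complex ^ 'n) set \<Rightarrow> bool" where
  "gromov_k_hyperbolic D \<longleftrightarrow> gromov_hyperbolic D (kobayashi D)"

text \<open>The product of two domains as a subset of the complex space of dimension
  \<open>CARD('m) + CARD('n)\<close>, whose coordinates are indexed by the sum type.\<close>

definition domain_prod ::
    "(complex ^ 'm) set \<Rightarrow> (complex ^ 'n) set \<Rightarrow> (complex ^ ('m + 'n)) set" where
  "domain_prod D1 D2 = {z. (\<chi> i. z $ Inl i) \<in> D1 \<and> (\<chi> j. z $ Inr j) \<in> D2}"

end

theory Submission imports Defs begin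

text \<open>
  In a product with the maximum metric, two long geodesics already violate the four-point
  condition. Let \<open>m\<close> be the midpoint of a geodesic from \<open>a\<close> to \<open>b\<close> of length \<open>2 * M\<close> in the first
  factor, and let \<open>a'\<close>, \<open>m'\<close>, \<open>b'\<close> be likewise in the second. The points
  \<open>p = (a, m')\<close>, \<open>x = (m, a')\<close>, \<open>q = (b, m')\<close>, \<open>w = (m, b')\<close> form a quadrilateral with sides
  of length \<open>M\<close> and both diagonals of length \<open>2 * M\<close>, so \<open>S(p, q, x, w)\<close>, which is the sum of the
  diagonals minus the larger sum of two opposite sides, equals \<open>2 * M\<close>. The Gromov
  condition therefore fails as soon as such geodesics exist in both factors for every \<open>M\<close>.

  Kobayashi distances need not have geodesics, but they are governed by chains of analytic discs.
  Parametrising discs by hyperbolic arc length makes chains behave like curves: a chain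
  of length \<open>t\<close> can be cut at any parameter (\<open>disc_chain_split\<close>), and two chains of the same length
  in the factors can be run simultaneously to give a chain of that length in the product
  (\<open>disc_chain_pair\<close>). The latter bounds the sides from above. The diagonals are bounded from
  below by projecting to a factor, which maps discs to discs and hence does not increase
  distances (\<open>chain_dist_le_kobayashi\<close>). Together these two estimates are as much of the product
  formula for the Kobayashi distance as the quadrilateral requires.

  Arbitrarily long almost geodesic chains exist because the distance from any fixed point is
  unbounded (\<open>chain_dist_unbounded\<close>). A bounded non-constant
  holomorphic function, normalised to have supremum 1 of its modulus, stays inside the unit disc by
  the maximum principle but comes arbitrarily close to the circle, and by the Schwarz-Pick lemma
  it does not increase hyperbolic distance along a chain.
\<close>

section \<open>Hyperbolic tangent and the unit disc\<close>

lemma tanh_artanh_real: "\<bar>x\<bar> < 1 \<Longrightarrow> tanh (artanh x) = (x::real)"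
proof -
  assume x: "\<bar>x\<bar> < 1"
  then have q: "(1 + x) / (1 - x) > 0" by (intro divide_pos_pos) auto
  have "exp (- 2 * artanh x) = inverse ((1 + x) / (1 - x))"
    using q by (simp add: artanh_def exp_minus)
  also have "\<dots> = (1 - x) / (1 + x)" by simp
  finally have "tanh (artanh x) = (1 - (1 - x) / (1 + x)) / (1 + (1 - x) / (1 + x))"
    by (simp only: tanh_real_altdef)
  also have "\<dots> = x" using x by (simp add: field_simps)
  finally show ?thesis .
qed

lemma artanh_real_nonneg: "0 \<le> x \<Longrightarrow> x < 1 \<Longrightarrow> 0 \<le> artanh (x::real)"
  by (metis abs_of_nonneg tanh_artanh_real tanh_real_nonneg_iff)

lemma norm_tanh_less_1: "cmod (of_real (tanh s)) < 1"
  using tanh_real_bounds[of s] by (simp add: abs_less_iff)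

text \<open>In the hyperbolic arc length parametrisation \<open>tanh\<close> of the real diameter, the Moebius maps
  with real parameter act as translations. This is what lets discs be cut and
  recentred below.\<close>

lemma Moebius_function_tanh:
  "Moebius_function 0 (- of_real (tanh b)) (of_real (tanh s)) = of_real (tanh (b + s))"
  by (simp add: Moebius_function_def tanh_add add.commute)

text \<open>Rotating two points of the disc onto a common radius does not increase their
  pseudohyperbolic distance. After squaring, both sides are affine in \<open>Re (cnj u * v)\<close>; they agree
  when this equals \<open>cmod u * cmod v\<close>, its largest value, and away from it the difference is the
  displayed product of nonnegative factors.\<close>

lemma norm_diff_pseudo_hyperbolic:
  fixes u v :: complex
  assumes "cmod u < 1" "cmod v < 1"
  shows "(cmod v - cmod u) * cmod (1 - cnj u * v) \<le> cmod (v - u) * (1 - cmod u * cmod v)"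
proof (rule power2_le_imp_le)
  define a b R where "a = cmod u" and "b = cmod v" and "R = Re (cnj u * v)"
  have 1: "(cmod (1 - cnj u * v))\<^sup>2 = 1 - 2 * R + a\<^sup>2 * b\<^sup>2"
    unfolding a_def b_def R_def cmod_power2
    by (simp add: power2_eq_square algebra_simps)
  have 2: "(cmod (v - u))\<^sup>2 = a\<^sup>2 + b\<^sup>2 - 2 * R"
    unfolding a_def b_def R_def cmod_power2
    by (simp add: power2_eq_square algebra_simps)
  have "R \<le> a * b"
    unfolding a_def b_def R_def by (metis complex_Re_le_cmod complex_mod_cnj norm_mult)
  moreover have "a\<^sup>2 \<le> 1" "b\<^sup>2 \<le> 1"
    using assms by (auto simp: a_def b_def power_le_one)
  ultimately have "0 \<le> 2 * (a * b - R) * ((1 - a\<^sup>2) * (1 - b\<^sup>2))" by simp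
  also have "\<dots> = (a\<^sup>2 + b\<^sup>2 - 2 * R) * (1 - a * b)\<^sup>2 - (b - a)\<^sup>2 * (1 - 2 * R + a\<^sup>2 * b\<^sup>2)"
    by (simp add: power2_eq_square algebra_simps)
  finally show "((cmod v - cmod u) * cmod (1 - cnj u * v))\<^sup>2
      \<le> (cmod (v - u) * (1 - cmod u * cmod v))\<^sup>2"
    by (simp add: power_mult_distrib 1 2 flip: a_def b_def)
next
  have "cmod u * cmod v \<le> 1"
    using assms by (simp add: mult_le_one)
  then show "0 \<le> cmod (v - u) * (1 - cmod u * cmod v)" by simp
qed

text \<open>The Schwarz-Pick lemma as an estimate of the hyperbolic distance from the origin, in the
  additive form that can be iterated along a chain of discs.\<close>

lemma Schwarz_Pick_tanh:
  assumes hol: "g holomorphic_on ball 0 1" and lt1: "\<And>z. cmod z < 1 \<Longrightarrow> cmod (g z) < 1"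
    and r: "cmod (g 0) \<le> tanh r" and s: "0 \<le> s"
  shows "cmod (g (of_real (tanh s))) \<le> tanh (r + s)"
proof -
  define u v \<tau> where "u = g 0" and "v = g (of_real (tanh s))" and "\<tau> = tanh s"
  have u: "cmod u < 1" and v: "cmod v < 1"
    using lt1 norm_tanh_less_1 by (auto simp: u_def v_def)
  have \<tau>: "0 \<le> \<tau>" "\<tau> < 1" using s tanh_real_bounds[of s] by (auto simp: \<tau>_def)
  let ?M = "Moebius_function 0 u \<circ> g"
  have "?M holomorphic_on ball 0 1"
    by (rule holomorphic_on_compose_gen[OF hol Moebius_function_holomorphic[OF u]])
       (use lt1 in auto)
  moreover have "?M 0 = 0" by (simp add: u_def Moebius_function_eq_zero)
  moreover have "cmod (?M z) < 1" if "cmod z < 1" for z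
    using Moebius_function_norm_lt_1[OF u lt1[OF that]] by simp
  ultimately have "cmod (?M (of_real \<tau>)) \<le> cmod (of_real \<tau>)"
    using Schwarz_Lemma(1) norm_tanh_less_1 \<tau>_def by blast
  then have "cmod ((v - u) / (1 - cnj u * v)) \<le> \<tau>"
    using \<tau> by (simp add: Moebius_function_simple v_def \<tau>_def)
  moreover have "1 - cnj u * v \<noteq> 0"
  proof
    assume "1 - cnj u * v = 0"
    then have "cmod u * cmod v = 1"
      by (metis complex_mod_cnj eq_iff_diff_eq_0 norm_mult norm_one)
    then show False using u v
      by (metis mult.left_neutral mult_less_cancel_right norm_ge_zero not_less order_less_le_trans
          mult_left_le mult.commute less_imp_le)
  qed
  then have pos: "0 < cmod (1 - cnj u * v)" by simp
  ultimately have "cmod (v - u) \<le> \<tau> * cmod (1 - cnj u * v)"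
    by (simp add: norm_divide divide_le_eq)
  moreover have uv: "0 \<le> 1 - cmod u * cmod v" using u v by (simp add: mult_le_one)
  ultimately have "(cmod v - cmod u) * cmod (1 - cnj u * v)
      \<le> (\<tau> * cmod (1 - cnj u * v)) * (1 - cmod u * cmod v)"
    using norm_diff_pseudo_hyperbolic[OF u v] mult_right_mono order_trans by meson
  also have "\<dots> = (\<tau> * (1 - cmod u * cmod v)) * cmod (1 - cnj u * v)" by simp
  finally have key: "cmod v - cmod u \<le> \<tau> * (1 - cmod u * cmod v)"
    using pos by (rule mult_right_le_imp_le)
  \<comment> \<open>The key inequality is solved for \<open>cmod v\<close>; the bound is the addition formula for \<open>tanh\<close>.\<close>
  define r' where "r' = artanh (cmod u)"
  have r': "tanh r' = cmod u" using u by (simp add: r'_def tanh_artanh_real)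
  have "cmod v * (1 + cmod u * \<tau>) \<le> cmod u + \<tau>"
    using key by (simp add: algebra_simps)
  moreover have "1 + cmod u * \<tau> > 0" using \<tau> by (simp add: add_pos_nonneg)
  ultimately have "cmod v \<le> (cmod u + \<tau>) / (1 + cmod u * \<tau>)" by (simp add: le_divide_eq)
  also have "\<dots> = tanh (r' + s)" by (simp add: tanh_add r' \<tau>_def)
  also have "\<dots> \<le> tanh (r + s)"
    using r r' by (simp add: u_def flip: tanh_real_le_iff[of r' r])
  finally show ?thesis by (simp add: v_def)
qed

section \<open>Analytic discs\<close>

lemma analytic_disc_compose:
  assumes \<phi>: "analytic_disc D \<phi>" and hol: "m holomorphic_on ball 0 1"
    and lt1: "\<And>z. cmod z < 1 \<Longrightarrow> cmod (m z) < 1"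
  shows "analytic_disc D (\<lambda>z. \<phi> (m z))"
  unfolding analytic_disc_def
proof (intro conjI allI)
  fix i
  have "((\<lambda>z. \<phi> z $ i) \<circ> m) holomorphic_on ball 0 1"
    by (rule holomorphic_on_compose_gen[OF hol, where t = "ball 0 1"])
       (use \<phi> lt1 in \<open>auto simp: analytic_disc_def\<close>)
  then show "(\<lambda>z. \<phi> (m z) $ i) holomorphic_on ball 0 1" by (simp add: o_def)
next
  show "(\<lambda>z. \<phi> (m z)) ` ball 0 1 \<subseteq> D"
    using \<phi> lt1 unfolding analytic_disc_def by auto
qed

lemma analytic_disc_const: "z \<in> D \<Longrightarrow> analytic_disc D (\<lambda>_. z)"
  by (auto simp: analytic_disc_def)

lemma analytic_disc_in: "analytic_disc D \<phi> \<Longrightarrow> cmod \<zeta> < 1 \<Longrightarrow> \<phi> \<zeta> \<in> D"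
  by (auto simp: analytic_disc_def image_subset_iff)

text \<open>The chain rule: complex linearity of the Frechet derivative of \<open>f\<close> turns the real derivative
  of the composite into multiplication by a complex number.\<close>

lemma holomorphic_on_analytic_disc:
  fixes \<phi> :: "complex \<Rightarrow> complex ^ 'n"
  assumes f: "holomorphic_fun D f" and \<phi>: "analytic_disc D \<phi>"
  shows "(\<lambda>z. f (\<phi> z)) holomorphic_on ball 0 1"
proof -
  have "\<exists>d. ((\<lambda>z. f (\<phi> z)) has_field_derivative d) (at x)" if x: "x \<in> ball 0 1" for x
  proof -
    have "\<exists>d. ((\<lambda>z. \<phi> z $ i) has_field_derivative d) (at x)" for i
      using \<phi> x unfolding analytic_disc_def
      by (metis field_differentiable_def holomorphic_on_imp_differentiable_at open_ball)
    then obtain v where v: "\<And>i. ((\<lambda>z. \<phi> z $ i) has_field_derivative v i) (at x)" by metis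
    have "(\<phi> has_derivative (\<lambda>h. h *s vec_lambda v)) (at x)"
    proof (subst has_derivative_componentwise_within, intro ballI)
      fix b :: "complex ^ 'n" assume "b \<in> Basis"
      then obtain i c where b: "b = axis i c" by (auto simp: Basis_vec_def)
      have "((\<lambda>z. \<phi> z $ i) has_derivative (\<lambda>h. h * v i)) (at x)"
        using v[of i] by (simp add: has_field_derivative_def mult.commute[of _ "v i"])
      then show "((\<lambda>z. \<phi> z \<bullet> b) has_derivative (\<lambda>h. (h *s vec_lambda v) \<bullet> b)) (at x)"
        unfolding b inner_axis vector_smult_component vec_lambda_beta
        by (rule has_derivative_inner_left)
    qed
    moreover have "\<phi> x \<in> D" using \<phi> x by (auto simp: analytic_disc_def)
    then obtain f' where f': "(f has_derivative f') (at (\<phi> x))" "\<And>c v. f' (c *s v) = c * f' v"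
      using f unfolding holomorphic_fun_def by blast
    ultimately have "((\<lambda>z. f (\<phi> z)) has_derivative (\<lambda>h. f' (h *s vec_lambda v))) (at x)"
      using has_derivative_compose by blast
    then show ?thesis
      by (auto simp: has_field_derivative_def f'(2) mult.commute[of _ "f' _"])
  qed
  then show ?thesis
    by (meson field_differentiable_def field_differentiable_at_within holomorphic_onI)
qed

text \<open>The endpoint is placed on the positive real axis and encoded by its hyperbolic distance
  from 0, so that lengths of steps can be added and divided.\<close>

definition disc_step :: "(complex ^ 'n) set \<Rightarrow> real \<Rightarrow> complex ^ 'n \<Rightarrow> complex ^ 'n \<Rightarrow> bool" where
  "disc_step D s z w \<longleftrightarrow>
     0 \<le> s \<and> (\<exists>\<phi>. analytic_disc D \<phi> \<and> \<phi> 0 = z \<and> \<phi> (of_real (tanh s)) = w)"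

text \<open>Every hyperbolic segment on the real diameter of a disc is itself a step: recentre the disc at
  the initial point of the segment.\<close>

lemma disc_step_along:
  assumes \<phi>: "analytic_disc D \<phi>" and s: "0 \<le> s"
  shows "disc_step D s (\<phi> (of_real (tanh b))) (\<phi> (of_real (tanh (b + s))))"
proof -
  let ?m = "Moebius_function 0 (- of_real (tanh b))"
  have b: "cmod (- of_real (tanh b)) < 1" using norm_tanh_less_1[of b] by simp
  have "analytic_disc D (\<lambda>z. \<phi> (?m z))"
    by (intro analytic_disc_compose[OF \<phi>] Moebius_function_holomorphic
        Moebius_function_norm_lt_1 b)
  moreover have "?m 0 = of_real (tanh b)" by (simp add: Moebius_function_simple)
  ultimately show ?thesis
    using s unfolding disc_step_def by (metis Moebius_function_tanh)
qed

lemma disc_step_split: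
  assumes "disc_step D s z w" "0 \<le> r" "r \<le> s"
  shows "\<exists>y. disc_step D r z y \<and> disc_step D (s - r) y w"
proof -
  obtain \<phi> where \<phi>: "analytic_disc D \<phi>" "\<phi> 0 = z" "\<phi> (of_real (tanh s)) = w"
    using assms unfolding disc_step_def by auto
  show ?thesis
    using disc_step_along[OF \<phi>(1), of r 0] disc_step_along[OF \<phi>(1), of "s - r" r] \<phi> assms
    by auto
qed

text \<open>Traversing a disc backwards is moving forwards along its reflection \<open>\<phi> (- \<zeta>)\<close>, from
  parameter \<open>- s\<close> to 0.\<close>

lemma disc_step_sym: "disc_step D s z w \<Longrightarrow> disc_step D s w z"
proof -
  assume "disc_step D s z w"
  then obtain \<phi> where \<phi>: "analytic_disc D \<phi>" "\<phi> 0 = z" "\<phi> (of_real (tanh s)) = w" and s: "0 \<le> s"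
    unfolding disc_step_def by auto
  have "analytic_disc D (\<lambda>\<zeta>. \<phi> (- \<zeta>))"
    by (rule analytic_disc_compose[OF \<phi>(1)]) (auto intro!: holomorphic_intros)
  from disc_step_along[OF this s, of "- s"] show ?thesis using \<phi> by simp
qed

lemma disc_step_in: "disc_step D s z w \<Longrightarrow> z \<in> D \<and> w \<in> D"
  unfolding disc_step_def analytic_disc_def
  using norm_tanh_less_1[of s] by (metis image_subset_iff mem_ball_0 norm_zero zero_less_one)

lemma disc_step_lempert: "disc_step D s z w \<Longrightarrow> lempert D z w \<le> ereal s"
proof -
  assume "disc_step D s z w"
  then obtain \<phi> where \<phi>: "analytic_disc D \<phi>" "\<phi> 0 = z" "\<phi> (of_real (tanh s)) = w" and s: "0 \<le> s"
    unfolding disc_step_def by auto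
  have "artanh (cmod (of_real (tanh s))) = s" using s by (simp add: artanh_tanh_real)
  then show ?thesis
    unfolding lempert_def
    by (intro Inf_lower CollectI exI[of _ "of_real (tanh s)"]) (use \<phi> norm_tanh_less_1[of s] in auto)
qed

text \<open>Rotating the disc moves \<open>\<alpha>\<close> to the positive axis. For \<open>\<alpha> = 0\<close> the factor \<open>sgn \<alpha>\<close> is 0 and the
  rotated disc is constant, which is still a step of length 0.\<close>

lemma disc_step_of_analytic_disc:
  assumes \<phi>: "analytic_disc D \<phi>" and \<alpha>: "cmod \<alpha> < 1"
  shows "disc_step D (artanh (cmod \<alpha>)) (\<phi> 0) (\<phi> \<alpha>)"
proof -
  have *: "cmod (sgn \<alpha> * z) < 1" if "cmod z < 1" for z
    using that by (simp add: norm_mult norm_sgn)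
  have "analytic_disc D (\<lambda>\<zeta>. \<phi> (sgn \<alpha> * \<zeta>))"
    by (rule analytic_disc_compose[OF \<phi> _ *]) (auto intro!: holomorphic_intros)
  moreover have "sgn \<alpha> * of_real (cmod \<alpha>) = \<alpha>"
    by (cases "\<alpha> = 0") (simp_all add: sgn_eq)
  ultimately show ?thesis
    unfolding disc_step_def using \<alpha>
    by (intro conjI exI[of _ "\<lambda>\<zeta>. \<phi> (sgn \<alpha> * \<zeta>)"])
       (auto simp: tanh_artanh_real artanh_real_nonneg)
qed

text \<open>The complex line through \<open>a\<close> and \<open>x\<close> meets the ball in a round disc centred at \<open>a\<close>; scaled to
  the unit disc, it has \<open>x\<close> at the parameter \<open>norm (x - a) / r\<close>.\<close>

lemma disc_step_ball:
  assumes sub: "ball a r \<subseteq> D" and x: "x \<in> ball a r"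
  shows "\<exists>s. disc_step D s a x"
proof -
  have r: "r > 0" using x by (metis ball_eq_empty emptyE not_le)
  define \<alpha> where "\<alpha> = norm (x - a) / r"
  define \<phi> where "\<phi> \<zeta> = a + \<zeta> *s (inverse (of_real \<alpha>) *s (x - a))" for \<zeta> :: complex
  show ?thesis
  proof (cases "x = a")
    case True
    then have "disc_step D 0 a x"
      using subsetD[OF sub x] by (auto simp: disc_step_def intro!: exI[of _ "\<lambda>_. a"] analytic_disc_const)
    then show ?thesis by blast
  next
    case False
    have \<alpha>: "0 < \<alpha>" "\<alpha> < 1"
      using False x r by (auto simp: \<alpha>_def dist_norm norm_minus_commute)
    have nx: "norm (x - a) = \<alpha> * r" using r by (simp add: \<alpha>_def)
    have dist_add_norm: "dist a (a + v) = norm v" for v by (simp add: dist_norm)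
    have ns: "norm (c *s v) = cmod c * norm v" for c and v :: "complex ^ 'a"
      by (simp add: norm_vec_def vector_scalar_mult_def norm_mult L2_set_right_distrib)
    have "analytic_disc D \<phi>"
      unfolding analytic_disc_def
    proof (intro conjI allI)
      fix i show "(\<lambda>\<zeta>. \<phi> \<zeta> $ i) holomorphic_on ball 0 1"
        unfolding \<phi>_def by (auto intro!: holomorphic_intros)
    next
      have "\<phi> \<zeta> \<in> ball a r" if "cmod \<zeta> < 1" for \<zeta>
      proof -
        have "norm (\<zeta> *s (inverse (of_real \<alpha>) *s (x - a))) = cmod \<zeta> * r"
          using \<alpha> nx unfolding ns by (simp add: norm_inverse)
        also have "\<dots> < r" using that r by simp
        finally show ?thesis
          unfolding \<phi>_def mem_ball dist_add_norm .
      qed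
      then show "\<phi> ` ball 0 1 \<subseteq> D" using sub by auto
    qed
    from disc_step_of_analytic_disc[OF this, of "of_real \<alpha>"] show ?thesis
      using \<alpha> by (auto simp: \<phi>_def)
  qed
qed

section \<open>Chains of discs\<close>

inductive disc_chain :: "(complex ^ 'n) set \<Rightarrow> complex ^ 'n \<Rightarrow> complex ^ 'n \<Rightarrow> real \<Rightarrow> bool"
  for D where
  nil: "z \<in> D \<Longrightarrow> disc_chain D z z 0"
| cons: "disc_step D s z y \<Longrightarrow> disc_chain D y w t \<Longrightarrow> disc_chain D z w (s + t)"

lemma disc_chain_in: "disc_chain D z w t \<Longrightarrow> z \<in> D \<and> w \<in> D"
  by (induction rule: disc_chain.induct) (auto dest: disc_step_in)

lemma disc_chain_nonneg: "disc_chain D z w t \<Longrightarrow> 0 \<le> t"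
  by (induction rule: disc_chain.induct) (auto simp: disc_step_def)

lemma disc_chain_step: "disc_step D s z w \<Longrightarrow> disc_chain D z w s"
  using disc_chain.cons[OF _ disc_chain.nil] disc_step_in by fastforce

text \<open>A constant disc is a step of any length, so a chain may rest at a point while another chain
  moves.\<close>

lemma disc_chain_const: "z \<in> D \<Longrightarrow> 0 \<le> t \<Longrightarrow> disc_chain D z z t"
  by (intro disc_chain_step) (auto simp: disc_step_def intro!: exI[of _ "\<lambda>_. z"] analytic_disc_const)

lemma disc_chain_trans:
  "disc_chain D z y s \<Longrightarrow> disc_chain D y w t \<Longrightarrow> disc_chain D z w (s + t)"
  by (induction rule: disc_chain.induct) (auto simp: add.assoc intro: disc_chain.cons)

lemma disc_chain_sym: "disc_chain D z w t \<Longrightarrow> disc_chain D w z t"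
proof (induction rule: disc_chain.induct)
  case (cons s z y w t)
  then show ?case
    using disc_chain_trans disc_chain_step disc_step_sym add.commute by metis
qed (rule disc_chain.nil)

lemma disc_chain_split:
  "disc_chain D z w t \<Longrightarrow> 0 \<le> r \<Longrightarrow> r \<le> t \<Longrightarrow> \<exists>y. disc_chain D z y r \<and> disc_chain D y w (t - r)"
proof (induction arbitrary: r rule: disc_chain.induct)
  case (nil z)
  then have "r = 0" by simp
  with nil show ?case by (auto intro: disc_chain.nil)
next
  case (cons s z y w t)
  show ?case
  proof (cases "r \<le> s")
    case True
    then obtain x where "disc_step D r z x" "disc_step D (s - r) x y"
      using disc_step_split cons by blast
    then have "disc_chain D z x r" "disc_chain D x w ((s - r) + t)"
      using cons by (auto intro: disc_chain_step disc_chain.cons)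
    then show ?thesis by (auto simp: algebra_simps)
  next
    case False
    then obtain x where "disc_chain D y x (r - s)" "disc_chain D x w (t - (r - s))"
      using cons.IH[of "r - s"] cons.prems by auto
    then show ?thesis
      using disc_chain.cons[OF cons.hyps(1), of x "r - s"] by (auto simp: algebra_simps)
  qed
qed

text \<open>Being joined by a chain is an equivalence relation whose classes are open, by
  \<open>disc_step_ball\<close>, so a connected domain is a single class.\<close>

lemma disc_chain_exists:
  assumes "domain_Cn D" "z \<in> D" "w \<in> D"
  shows "\<exists>t. disc_chain D z w t"
proof (rule connected_equivalence_relation[where S = D and R = "\<lambda>z w. \<exists>t. disc_chain D z w t"])
  show "connected D" using assms by (simp add: domain_Cn_def)
  fix a assume "a \<in> D"
  then obtain r where "r > 0" "ball a r \<subseteq> D"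
    using assms open_contains_ball unfolding domain_Cn_def by metis
  then have "openin (top_of_set D) (ball a r) \<and> a \<in> ball a r \<and>
      (\<forall>x \<in> ball a r. \<exists>t. disc_chain D a x t)"
    using disc_step_ball disc_chain_step by (metis centre_in_ball open_ball open_openin_trans
        open_subset)
  then show "\<exists>T. openin (top_of_set D) T \<and> a \<in> T \<and> (\<forall>x \<in> T. \<exists>t. disc_chain D a x t)" by blast
qed (use assms disc_chain_sym disc_chain_trans in blast)+

section \<open>The chain distance and the Kobayashi distance\<close>

definition chain_dist :: "(complex ^ 'n) set \<Rightarrow> complex ^ 'n \<Rightarrow> complex ^ 'n \<Rightarrow> real" where
  "chain_dist D z w = Inf {t. disc_chain D z w t}"

lemma chain_dist_le: "disc_chain D z w t \<Longrightarrow> chain_dist D z w \<le> t"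
  unfolding chain_dist_def
  by (rule cInf_lower) (auto intro!: bdd_belowI[of _ 0] disc_chain_nonneg)

lemma chain_dist_ge:
  assumes "domain_Cn D" "z \<in> D" "w \<in> D" "\<And>t. disc_chain D z w t \<Longrightarrow> c \<le> t"
  shows "c \<le> chain_dist D z w"
  unfolding chain_dist_def
  by (rule cInf_greatest) (use assms disc_chain_exists in auto)

lemma chain_dist_approx:
  assumes "domain_Cn D" "z \<in> D" "w \<in> D" "0 < e"
  obtains t where "disc_chain D z w t" "t < chain_dist D z w + e"
  using cInf_lessD[of "{t. disc_chain D z w t}" "chain_dist D z w + e"] assms
    disc_chain_exists[OF assms(1-3)] by (auto simp: chain_dist_def)

lemma chain_dist_triangle:
  assumes "domain_Cn D" "x \<in> D" "y \<in> D" "z \<in> D"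
  shows "chain_dist D x z \<le> chain_dist D x y + chain_dist D y z"
proof (rule field_le_epsilon)
  fix e :: real assume "0 < e"
  then have e: "0 < e / 2" by simp
  obtain s t where "disc_chain D x y s" "s < chain_dist D x y + e / 2"
    and "disc_chain D y z t" "t < chain_dist D y z + e / 2"
    using chain_dist_approx[OF assms(1) _ _ e] assms by metis
  then show "chain_dist D x z \<le> chain_dist D x y + chain_dist D y z + e"
    using chain_dist_le[OF disc_chain_trans] by fastforce
qed

lemma pseudodistance_chain_dist:
  assumes "domain_Cn D"
  shows "pseudodistance_on D (chain_dist D)"
  unfolding pseudodistance_on_def
proof (intro conjI ballI)
  fix x y assume xy: "x \<in> D" "y \<in> D"
  show "0 \<le> chain_dist D x y"
    using chain_dist_ge[OF assms xy] disc_chain_nonneg by blast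
  show "chain_dist D x y = chain_dist D y x"
    unfolding chain_dist_def by (rule arg_cong[where f = Inf]) (auto dest: disc_chain_sym)
next
  fix x assume "x \<in> D"
  show "chain_dist D x x = 0"
    using chain_dist_le[OF disc_chain.nil] chain_dist_ge[OF assms, of x x 0] disc_chain_nonneg
    by (metis \<open>x \<in> D\<close> order_antisym)
qed (use chain_dist_triangle assms in blast)

text \<open>The reason why chains govern the Kobayashi distance: any competitor in its definition is
  bounded by the length of each step, hence by the triangle inequality by the length of the chain.\<close>

lemma pseudodistance_le_chain:
  assumes d: "pseudodistance_on E d" and le: "\<forall>x\<in>E. \<forall>y\<in>E. ereal (d x y) \<le> lempert E x y"
  shows "disc_chain E p q t \<Longrightarrow> d p q \<le> t"
proof (induction rule: disc_chain.induct)
  case (nil z)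
  then show ?case using d by (simp add: pseudodistance_on_def)
next
  case (cons s z y w t)
  have E: "z \<in> E" "y \<in> E" "w \<in> E" using cons disc_step_in disc_chain_in by blast+
  then have "ereal (d z y) \<le> ereal s"
    using le disc_step_lempert[OF cons.hyps(1)] order_trans by blast
  moreover have "d z w \<le> d z y + d y w" using d E unfolding pseudodistance_on_def by blast
  ultimately show ?case using cons.IH by simp
qed

lemma kobayashi_le_chain:
  assumes "disc_chain E p q t"
  shows "kobayashi E p q \<le> t"
proof -
  have "pseudodistance_on E (\<lambda>_ _. 0)" by (simp add: pseudodistance_on_def)
  moreover have "ereal 0 \<le> lempert E x y" for x y
    unfolding lempert_def
    by (intro Inf_greatest) (auto simp: artanh_real_nonneg simp flip: zero_ereal_def)
  ultimately have "{d p q |d. pseudodistance_on E d \<and>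
      (\<forall>x\<in>E. \<forall>y\<in>E. ereal (d x y) \<le> lempert E x y)} \<noteq> {}" by blast
  then show ?thesis
    unfolding kobayashi_def using assms disc_chain_in[OF assms]
    by (auto intro!: cSup_least intro: pseudodistance_le_chain)
qed

text \<open>A map \<open>\<pi>\<close> that sends discs to discs does not increase distances: the chain distance pulled
  back along \<open>\<pi>\<close> is one of the pseudodistances over which the Kobayashi distance is the supremum.
  The chain from \<open>p\<close> to \<open>q\<close> makes that supremum finite.\<close>

lemma chain_dist_le_kobayashi:
  assumes D: "domain_Cn D" and \<pi>: "\<And>\<phi>. analytic_disc E \<phi> \<Longrightarrow> analytic_disc D (\<lambda>\<zeta>. \<pi> (\<phi> \<zeta>))"
    and chain: "disc_chain E p q t"
  shows "chain_dist D (\<pi> p) (\<pi> q) \<le> kobayashi E p q"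
proof -
  let ?d = "\<lambda>x y. chain_dist D (\<pi> x) (\<pi> y)"
  have "\<pi> x \<in> D" if "x \<in> E" for x
    using \<pi>[OF analytic_disc_const[OF that]] unfolding analytic_disc_def
    by (metis centre_in_ball image_subset_iff zero_less_one)
  then have d: "pseudodistance_on E ?d"
    using pseudodistance_chain_dist[OF D] unfolding pseudodistance_on_def by blast
  have le: "ereal (?d x y) \<le> lempert E x y" for x y
    unfolding lempert_def
  proof (rule Inf_greatest, clarify)
    fix \<alpha> \<phi> assume "\<alpha> \<in> ball (0::complex) 1" "analytic_disc E \<phi>"
    then have "disc_step D (artanh (cmod \<alpha>)) (\<pi> (\<phi> 0)) (\<pi> (\<phi> \<alpha>))"
      using disc_step_of_analytic_disc[OF \<pi>] by auto
    then show "ereal (?d (\<phi> 0) (\<phi> \<alpha>)) \<le> ereal (artanh (cmod \<alpha>))"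
      by (simp add: chain_dist_le disc_chain_step)
  qed
  let ?S = "{d p q | d. pseudodistance_on E d \<and> (\<forall>x\<in>E. \<forall>y\<in>E. ereal (d x y) \<le> lempert E x y)}"
  have "?d p q \<in> ?S" by (intro CollectI exI[of _ ?d]) (simp add: d le)
  moreover have "bdd_above ?S"
    using pseudodistance_le_chain[OF _ _ chain] by (auto intro!: bdd_aboveI[of _ t])
  ultimately have "?d p q \<le> Sup ?S" by (rule cSup_upper)
  then show ?thesis
    using disc_chain_in[OF chain] by (simp add: kobayashi_def)
qed

section \<open>Products\<close>

definition vec_pair :: "complex ^ 'm \<Rightarrow> complex ^ 'n \<Rightarrow> complex ^ ('m + 'n)" where
  "vec_pair z w = (\<chi> k. case k of Inl i \<Rightarrow> z $ i | Inr j \<Rightarrow> w $ j)"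

definition vec_fst :: "complex ^ ('m::finite + 'n::finite) \<Rightarrow> complex ^ 'm" where
  "vec_fst z = (\<chi> i. z $ Inl i)"

definition vec_snd :: "complex ^ ('m::finite + 'n::finite) \<Rightarrow> complex ^ 'n" where
  "vec_snd z = (\<chi> j. z $ Inr j)"

lemma vec_fst_pair [simp]: "vec_fst (vec_pair z w) = z"
  and vec_snd_pair [simp]: "vec_snd (vec_pair z w) = w"
  by (simp_all add: vec_fst_def vec_snd_def vec_pair_def vec_eq_iff)

lemma domain_prod_iff: "z \<in> domain_prod D1 D2 \<longleftrightarrow> vec_fst z \<in> D1 \<and> vec_snd z \<in> D2"
  by (simp add: domain_prod_def vec_fst_def vec_snd_def)

lemma analytic_disc_fst: "analytic_disc (domain_prod D1 D2) \<phi> \<Longrightarrow> analytic_disc D1 (\<lambda>\<zeta>. vec_fst (\<phi> \<zeta>))"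
  and analytic_disc_snd: "analytic_disc (domain_prod D1 D2) \<phi> \<Longrightarrow> analytic_disc D2 (\<lambda>\<zeta>. vec_snd (\<phi> \<zeta>))"
  by (auto simp: analytic_disc_def domain_prod_def vec_fst_def vec_snd_def)

lemma analytic_disc_pair:
  assumes "analytic_disc D1 \<phi>" "analytic_disc D2 \<psi>"
  shows "analytic_disc (domain_prod D1 D2) (\<lambda>\<zeta>. vec_pair (\<phi> \<zeta>) (\<psi> \<zeta>))"
  unfolding analytic_disc_def
proof (intro conjI allI)
  fix k show "(\<lambda>\<zeta>. vec_pair (\<phi> \<zeta>) (\<psi> \<zeta>) $ k) holomorphic_on ball 0 1"
    using assms by (cases k) (auto simp: vec_pair_def analytic_disc_def)
qed (use assms in \<open>auto simp: domain_prod_iff analytic_disc_in\<close>)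

lemma disc_step_pair:
  assumes "disc_step D1 s z y" "disc_step D2 s z' y'"
  shows "disc_step (domain_prod D1 D2) s (vec_pair z z') (vec_pair y y')"
  using assms analytic_disc_pair unfolding disc_step_def by metis

text \<open>The subdivisions of two chains in the factors do not match. Here a single
  disc in the first factor is cut to follow the subdivision of the chain in the second;
  the general case then cuts the second chain along the steps of the first.\<close>

lemma disc_step_chain_pair:
  assumes "disc_chain D2 z' y' s" "disc_step D1 s z y"
  shows "disc_chain (domain_prod D1 D2) (vec_pair z z') (vec_pair y y') s"
  using assms
proof (induction arbitrary: z rule: disc_chain.induct)
  case (nil z')
  then have "z = y" "z \<in> D1" using disc_step_in[OF nil.prems] by (auto simp: disc_step_def)
  then show ?case using nil by (auto intro!: disc_chain.nil simp: domain_prod_iff)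
next
  case (cons s z' x' y' t)
  have "0 \<le> s" "0 \<le> t" using cons.hyps disc_chain_nonneg by (auto simp: disc_step_def)
  then obtain x where "disc_step D1 s z x" "disc_step D1 t x y"
    using disc_step_split[OF cons.prems, of s] by auto
  then show ?case using cons disc_step_pair disc_chain.cons by metis
qed

lemma disc_chain_pair:
  assumes "disc_chain D1 z w t" "disc_chain D2 z' w' t"
  shows "disc_chain (domain_prod D1 D2) (vec_pair z z') (vec_pair w w') t"
  using assms
proof (induction arbitrary: z' rule: disc_chain.induct)
  case (nil z)
  have "disc_step D1 0 z z"
    using analytic_disc_const[OF nil(1)] by (auto simp: disc_step_def)
  then show ?case using nil disc_step_chain_pair by blast
next
  case (cons s z y w t)
  have "0 \<le> s" "0 \<le> t" using cons.hyps disc_chain_nonneg by (auto simp: disc_step_def)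
  then obtain y' where "disc_chain D2 z' y' s" "disc_chain D2 y' w' t"
    using disc_chain_split[OF cons.prems, of s] by auto
  then show ?case
    using disc_step_chain_pair cons.hyps(1) cons.IH disc_chain_trans by blast
qed

section \<open>Unboundedness\<close>

text \<open>The one-variable maximum principle makes \<open>f\<close> constant along every disc through a point where
  the maximum is attained, and the end of a step is again such a point. Chains carry the value
  to the whole domain.\<close>

lemma constant_on_if_sup_attained:
  assumes D: "domain_Cn D" and f: "holomorphic_fun D f"
    and z: "z \<in> D" and max: "\<And>x. x \<in> D \<Longrightarrow> cmod (f x) \<le> cmod (f z)"
  shows "f constant_on D"
proof -
  have step: "f y = f x" if "disc_step D s x y" and fx: "cmod (f x) = cmod (f z)" for s x y
  proof -
    obtain \<phi> where \<phi>: "analytic_disc D \<phi>" "\<phi> 0 = x" "\<phi> (of_real (tanh s)) = y"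
      using \<open>disc_step D s x y\<close> unfolding disc_step_def by auto
    have "(\<lambda>\<zeta>. f (\<phi> \<zeta>)) constant_on ball 0 1"
      by (rule maximum_modulus_principle[OF holomorphic_on_analytic_disc[OF f \<phi>(1)],
            where \<xi> = 0 and U = "ball 0 1"])
         (use \<phi> fx max in \<open>auto simp: analytic_disc_in\<close>)
    then show ?thesis
      using \<phi> norm_tanh_less_1[of s] unfolding constant_on_def
      by (metis mem_ball_0 norm_zero zero_less_one)
  qed
  have "cmod (f x) = cmod (f z) \<Longrightarrow> f y = f x" if "disc_chain D x y t" for x y t
    using that by (induction rule: disc_chain.induct) (auto dest: step)
  then show ?thesis
    unfolding constant_on_def using disc_chain_exists[OF D z] by metis
qed

lemma disc_chain_tanh_bound:
  assumes F: "holomorphic_fun D F" and lt1: "\<And>x. x \<in> D \<Longrightarrow> cmod (F x) < 1"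
  shows "disc_chain D z w t \<Longrightarrow> cmod (F z) \<le> tanh r \<Longrightarrow> cmod (F w) \<le> tanh (r + t)"
proof (induction arbitrary: r rule: disc_chain.induct)
  case (cons s z y w t)
  then obtain \<phi> where \<phi>: "analytic_disc D \<phi>" "\<phi> 0 = z" "\<phi> (of_real (tanh s)) = y" and s: "0 \<le> s"
    unfolding disc_step_def by auto
  have "cmod (F y) \<le> tanh (r + s)"
    using Schwarz_Pick_tanh[OF holomorphic_on_analytic_disc[OF F \<phi>(1)], of r s] \<phi> s cons.prems lt1
    by (auto simp: analytic_disc_in)
  from cons.IH[OF this] show ?case by (simp add: add.assoc)
qed simp

text \<open>Normalise the supremum of \<open>cmod f\<close> to 1. It is not attained, so the hyperbolic distance of the
  image from the origin is finite but unbounded, and by Schwarz-Pick a point where it exceeds that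
  of \<open>F a\<close> by \<open>M\<close> is at chain distance at least \<open>M\<close> from \<open>a\<close>.\<close>

lemma chain_dist_unbounded:
  assumes D: "domain_Cn D" and f: "holomorphic_fun D f" "bounded (f ` D)" "\<not> f constant_on D"
    and a: "a \<in> D"
  shows "\<exists>b\<in>D. M \<le> chain_dist D a b"
proof -
  define S where "S = (SUP x\<in>D. cmod (f x))"
  have bdd: "bdd_above ((\<lambda>x. cmod (f x)) ` D)"
    using f(2) by (auto simp: bounded_iff bdd_above_def)
  have le: "cmod (f x) \<le> S" if "x \<in> D" for x
    unfolding S_def using bdd that by (rule cSUP_upper2) simp
  then have lt: "cmod (f x) < S" if "x \<in> D" for x
    using constant_on_if_sup_attained[OF D f(1) that] f(3) that
    by (metis order_le_imp_less_or_eq)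
  have S: "S > 0" using lt[OF a] norm_ge_zero order_le_less_trans by blast
  define F where "F x = f x / of_real S" for x
  have F: "holomorphic_fun D F"
    unfolding holomorphic_fun_def
  proof
    fix x assume "x \<in> D"
    then obtain f' where f': "(f has_derivative f') (at x)" "\<And>c v. f' (c *s v) = c * f' v"
      using f(1) unfolding holomorphic_fun_def by blast
    have "(F has_derivative (\<lambda>h. f' h / of_real S)) (at x)"
      unfolding F_def using bounded_linear.has_derivative[OF bounded_linear_divide f'(1)] .
    then show "\<exists>F'. (F has_derivative F') (at x) \<and> (\<forall>c v. F' (c *s v) = c * F' v)"
      using f'(2) by (intro exI[of _ "\<lambda>h. f' h / of_real S"]) auto
  qed
  have F1: "cmod (F x) < 1" if "x \<in> D" for x
    using lt[OF that] S by (simp add: F_def norm_divide)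
  define r where "r = artanh (cmod (F a))"
  have r: "tanh r = cmod (F a)" using F1[OF a] by (simp add: r_def tanh_artanh_real)
  have "S * tanh (r + M) < S" using S tanh_real_lt_1 by simp
  then obtain b where b: "b \<in> D" "S * tanh (r + M) < cmod (f b)"
    unfolding S_def using less_cSUP_iff[OF _ bdd] a by fastforce
  then have Fb: "tanh (r + M) < cmod (F b)"
    using S by (simp add: F_def norm_divide less_divide_eq mult.commute)
  have "M \<le> t" if "disc_chain D a b t" for t
  proof -
    have "tanh (r + M) < tanh (r + t)"
      using disc_chain_tanh_bound[OF F F1 that, of r] r Fb by linarith
    then show ?thesis by simp
  qed
  then show ?thesis using chain_dist_ge[OF D a b(1)] b(1) by blast
qed

text \<open>Take a chain to a far point \<open>c\<close> whose length exceeds the distance by less than 1, and let \<open>m\<close>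
  and \<open>b\<close> be its points at parameters \<open>M\<close> and \<open>2 * M\<close>. By the triangle inequality an initial part of
  the chain is no more wasteful than the whole. Cutting at a prescribed length is what
  allows the same \<open>M\<close> in both factors.\<close>

lemma almost_geodesic_with_midpoint:
  assumes D: "domain_Cn D" and f: "holomorphic_fun D f" "bounded (f ` D)" "\<not> f constant_on D"
    and M: "0 \<le> M"
  obtains a m b where "disc_chain D a m M" "disc_chain D m b M" "2 * M - 1 \<le> chain_dist D a b"
proof -
  obtain a where a: "a \<in> D" using D by (auto simp: domain_Cn_def)
  obtain c where c: "c \<in> D" "2 * M \<le> chain_dist D a c"
    using chain_dist_unbounded[OF D f a] by blast
  obtain t where t: "disc_chain D a c t" "t < chain_dist D a c + 1"
    using chain_dist_approx[OF D a c(1), of 1] by auto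
  have "2 * M \<le> t" using c chain_dist_le[OF t(1)] by simp
  then obtain b where b: "disc_chain D a b (2 * M)" "disc_chain D b c (t - 2 * M)"
    using disc_chain_split[OF t(1), of "2 * M"] M by auto
  obtain m where m: "disc_chain D a m M" "disc_chain D m b M"
    using disc_chain_split[OF b(1), of M] M by auto
  have "chain_dist D a c \<le> chain_dist D a b + (t - 2 * M)"
    using chain_dist_triangle[OF D a _ c(1), of b] disc_chain_in[OF b(1)] chain_dist_le[OF b(2)]
    by linarith
  then have "2 * M - 1 \<le> chain_dist D a b" using t(2) by linarith
  with m that show ?thesis by blast
qed

section \<open>The four-point obstruction\<close>

theorem corollary1:
  fixes D1 :: "(complex ^ 'n1) set" and D2 :: "(complex ^ 'n2) set"
  assumes "domain_Cn D1" and "domain_Cn D2"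
    and "kobayashi_hyperbolic D1" and "kobayashi_hyperbolic D2"
    and "\<exists>f. holomorphic_fun D1 f \<and> bounded (f ` D1) \<and> \<not> f constant_on D1"
    and "\<exists>g. holomorphic_fun D2 g \<and> bounded (g ` D2) \<and> \<not> g constant_on D2"
  shows "\<not> gromov_k_hyperbolic (domain_prod D1 D2)"
proof
  let ?E = "domain_prod D1 D2"
  let ?k = "kobayashi ?E"
  assume "gromov_k_hyperbolic ?E"
  then obtain B where B: "\<And>p q x w. \<lbrakk>p \<in> ?E; q \<in> ?E; x \<in> ?E; w \<in> ?E\<rbrakk> \<Longrightarrow> gromov_S ?k p q x w \<le> B"
    unfolding gromov_k_hyperbolic_def gromov_hyperbolic_def bdd_above_def by blast
  \<comment> \<open>The quadrilateral below has defect at least \<open>2 * M - 2\<close>, which has to exceed \<open>B\<close>.\<close>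
  define M where "M = \<bar>B\<bar> + 2"
  have M: "0 \<le> M" by (simp add: M_def)
  obtain a m b where 1: "disc_chain D1 a m M" "disc_chain D1 m b M" "2 * M - 1 \<le> chain_dist D1 a b"
    using almost_geodesic_with_midpoint[OF assms(1) _ _ _ M] assms(5) by metis
  obtain a' m' b' where 2: "disc_chain D2 a' m' M" "disc_chain D2 m' b' M"
      "2 * M - 1 \<le> chain_dist D2 a' b'"
    using almost_geodesic_with_midpoint[OF assms(2) _ _ _ M] assms(6) by metis
  define p q x w where "p = vec_pair a m'" and "q = vec_pair b m'"
    and "x = vec_pair m a'" and "w = vec_pair m b'"
  note pqxw = p_def q_def x_def w_def
  have in1: "a \<in> D1" "m \<in> D1" "b \<in> D1" and in2: "a' \<in> D2" "m' \<in> D2" "b' \<in> D2"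
    using 1 2 disc_chain_in by blast+
  have E: "p \<in> ?E" "q \<in> ?E" "x \<in> ?E" "w \<in> ?E"
    using in1 in2 by (auto simp: pqxw domain_prod_iff)
  have sides: "?k p x \<le> M" "?k w q \<le> M" "?k x q \<le> M" "?k p w \<le> M"
    unfolding pqxw
    by (intro kobayashi_le_chain disc_chain_pair 1 2 1(1,2)[THEN disc_chain_sym]
        2(1,2)[THEN disc_chain_sym])+
  \<comment> \<open>Along each diagonal one factor rests at its midpoint while the other traverses its whole
    chain.\<close>
  have "disc_chain ?E p q (M + M)" "disc_chain ?E x w (M + M)"
    unfolding pqxw
    by (intro disc_chain_pair disc_chain_trans[OF 1(1,2)] disc_chain_trans[OF 2(1,2)]
        disc_chain_const; use M in1 in2 in simp)+
  then have "chain_dist D1 (vec_fst p) (vec_fst q) \<le> ?k p q"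
    and "chain_dist D2 (vec_snd w) (vec_snd x) \<le> ?k w x"
    and "chain_dist D2 (vec_snd x) (vec_snd w) \<le> ?k x w"
    using chain_dist_le_kobayashi[where \<pi> = vec_fst and E = ?E, OF assms(1)] analytic_disc_fst
      chain_dist_le_kobayashi[where \<pi> = vec_snd and E = ?E, OF assms(2)] analytic_disc_snd
      disc_chain_sym
    by metis+
  moreover have "chain_dist D2 b' a' = chain_dist D2 a' b'"
    using pseudodistance_chain_dist[OF assms(2)] in2 by (simp add: pseudodistance_on_def)
  ultimately have diagonals: "2 * M - 1 \<le> ?k p q" "2 * M - 1 \<le> ?k w x" "2 * M - 1 \<le> ?k x w"
    using 1(3) 2(3) by (simp_all add: pqxw)
  have "2 * M - 2 \<le> gromov_S ?k p q x w"
    using sides diagonals by (auto simp: gromov_S_def gromov_product_def min_def)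
  then have "2 * M - 2 \<le> B" using B[OF E] by linarith
  then show False by (simp add: M_def)
qed

end
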